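(* Let $G=(V,E\cup A)$ be a mixed graph and $k\ge 1$ an integer such that $E\cup A$ can be partitioned into $k$ matching forests. Then $E\cup A$ can be partitioned into $k$ matching forests $F_1,\dots,F_k$ such that, writing $M_i:=F_i\cap E$ and $B_i:=F_i\cap A$, for every $i,j\in\{1,\dots,k\}$ we have $\big||F_i|-|F_j|\big|\le 2$, $\big||M_i|-|M_j|\big|\le 1$, and $\big||B_i|-|B_j|\big|\le 2$.
   Context: A mixed graph $G=(V,E\cup A)$ has a finite vertex set $V$, a set $E$ of undirected edges and a set $A$ of directed arcs; there are no loops, but parallel edges/arcs are allowed. Each arc has one head; both endpoints of an edge are regarded as heads of that edge. A vertex $v$ is covered by $e\in E\cup A$ if $v$ is a head of $e$. A matching forest is a subset $F\subseteq E\cup A$ such that (i) the underlying undirected graph of $F$ has no cycle and (ii) every vertex of $V$ is covered at most once in $F$. *)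

theory Defs
  imports Main "HOL-Library.Disjoint_Sets"
begin

text \<open>
  Edges and arcs are abstract identifiers, so parallel edges and arcs are distinct elements with
  the same endpoints. The field \<open>ends\<close> gives the endpoint set of an edge or arc; \<open>head\<close> is only
  meaningful on arcs, the tail of an arc being its other endpoint.
\<close>
record ('v, 'e) mixed_graph =
  verts :: "'v set"
  edges :: "'e set"
  arcs :: "'e set"
  ends :: "'e \<Rightarrow> 'v set"
  head :: "'e \<Rightarrow> 'v"

text \<open>
  Two endpoints for every edge and arc means that there are no loops. Finiteness of the sets of
  edges and arcs is not required; it follows once they are partitioned into finitely many
  matching forests, see \<open>finite_matching_forest\<close> below.
\<close>
definition wf_mixed_graph :: "('v, 'e) mixed_graph \<Rightarrow> bool" where
  "wf_mixed_graph G \<longleftrightarrow>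
     finite (verts G) \<and>
     edges G \<inter> arcs G = {} \<and>
     (\<forall>e \<in> edges G \<union> arcs G. ends G e \<subseteq> verts G \<and> card (ends G e) = 2) \<and>
     (\<forall>a \<in> arcs G. head G a \<in> ends G a)"

definition heads :: "('v, 'e) mixed_graph \<Rightarrow> 'e \<Rightarrow> 'v set" where
  "heads G e = (if e \<in> edges G then ends G e else {head G e})"

definition covers :: "('v, 'e) mixed_graph \<Rightarrow> 'e \<Rightarrow> 'v \<Rightarrow> bool" where
  "covers G e v \<longleftrightarrow> v \<in> heads G e"

text \<open>
  A cycle of the underlying undirected multigraph: edge \<open>es ! i\<close> joins \<open>vs ! i\<close> to its cyclic
  successor. Orientations are ignored, and two parallel elements form a cycle of length 2.
\<close>
definition is_cycle :: "('v, 'e) mixed_graph \<Rightarrow> 'v list \<Rightarrow> 'e list \<Rightarrow> bool" where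
  "is_cycle G vs es \<longleftrightarrow>
     es \<noteq> [] \<and> length vs = length es \<and> distinct vs \<and> distinct es \<and>
     (\<forall>i < length es. ends G (es ! i) = {vs ! i, vs ! (Suc i mod length vs)})"

definition matching_forest :: "('v, 'e) mixed_graph \<Rightarrow> 'e set \<Rightarrow> bool" where
  "matching_forest G F \<longleftrightarrow>
     F \<subseteq> edges G \<union> arcs G \<and>
     (\<nexists>vs es. set es \<subseteq> F \<and> is_cycle G vs es) \<and>
     (\<forall>v \<in> verts G. \<forall>e \<in> F. \<forall>f \<in> F. covers G e v \<and> covers G f v \<longrightarrow> e = f)"

text \<open>The classes are indexed by \<open>1, \<dots>, k\<close>, and empty classes are allowed.\<close>
definition matching_forest_partition ::
    "('v, 'e) mixed_graph \<Rightarrow> nat \<Rightarrow> (nat \<Rightarrow> 'e set) \<Rightarrow> bool" where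
  "matching_forest_partition G k F \<longleftrightarrow>
     (\<forall>i \<in> {1..k}. matching_forest G (F i)) \<and>
     disjoint_family_on F {1..k} \<and>
     (\<Union>i \<in> {1..k}. F i) = edges G \<union> arcs G"

lemma finite_matching_forest:
  assumes G: "wf_mixed_graph G" and F: "matching_forest G F"
  shows "finite F"
proof -
  have "\<exists>v \<in> verts G. covers G e v" if "e \<in> F" for e
  proof -
    have e: "e \<in> edges G \<union> arcs G"
      using F that by (auto simp: matching_forest_def)
    then have sub: "ends G e \<subseteq> verts G" and "ends G e \<noteq> {}"
      using G by (fastforce simp: wf_mixed_graph_def)+
    then obtain u where "u \<in> ends G e" by blast
    then show ?thesis
      using G e sub by (cases "e \<in> edges G") (auto simp: wf_mixed_graph_def covers_def heads_def)
  qed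
  then obtain c where c: "\<And>e. e \<in> F \<Longrightarrow> c e \<in> verts G \<and> covers G e (c e)" by metis
  then have "inj_on c F"
    using F unfolding matching_forest_def inj_on_def by metis
  moreover have "finite (c ` F)"
    using c G by (auto simp: wf_mixed_graph_def intro: finite_subset[of _ "verts G"])
  ultimately show ?thesis using finite_imageD by blast
qed

end

theory Submission
  imports Defs
begin

text \<open>
  A matching forest is a matching \<open>M\<close> together with a branching \<open>B\<close> such that every vertex covered by
  \<open>M\<close> is a root of \<open>B\<close>. Given two disjoint matching forests with root sets \<open>R\<close> and \<open>S\<close>, consider the
  graph on the vertices whose edges are the edges of both matchings and, for each source component of
  the arcs that contains no common root, one pair of a vertex in \<open>R - S\<close> and a vertex in \<open>S - R\<close>. By
  Edmonds' theorem on disjoint branchings, exchanging the two forests on any union of connected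
  components of this graph again gives two matching forests. A component \<open>P\<close> has at least \<open>card P - 1\<close>
  edges, and counting roots then shows that on each component the two forests differ by at most one
  both in their number of edges and in their total size (arcs being counted at their heads). Choosing
  for each component whether to exchange makes the differences of the two forests as small as
  required, and a partition that minimises a sum of squares of the sizes is balanced for all pairs.
\<close>

section \<open>Disjoint branchings\<close>

text \<open>Cuts only ask whether an arc has its head in a set and some endpoint outside it. An arc
  is therefore a head together with a vertex set \<open>en a\<close>, and no tail is singled
  out.\<close>

locale directed_hypergraph =
  fixes V :: "'v set" and A :: "'e set" and h :: "'e \<Rightarrow> 'v" and en :: "'e \<Rightarrow> 'v set"
  assumes finite_V: "finite V" and finite_A: "finite A"
    and h_in_V: "a \<in> A \<Longrightarrow> h a \<in> V" and en_subset_V: "a \<in> A \<Longrightarrow> en a \<subseteq> V"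
begin

definition entering :: "'e set \<Rightarrow> 'v set \<Rightarrow> 'e set" where
  "entering B X = {a \<in> B. h a \<in> X \<and> \<not> en a \<subseteq> X}"

text \<open>
  Given the indegrees, acyclicity amounts to the last conjunct: a directed cycle is a set without
  roots that no arc enters.
\<close>
definition branching :: "'e set \<Rightarrow> 'v set \<Rightarrow> bool" where
  "branching B R \<longleftrightarrow> B \<subseteq> A \<and> R \<subseteq> V \<and>
     (\<forall>v \<in> V. card {a \<in> B. h a = v} = of_bool (v \<notin> R)) \<and>
     (\<forall>X \<subseteq> V. X \<noteq> {} \<longrightarrow> X \<inter> R = {} \<longrightarrow> entering B X \<noteq> {})"

lemma finite_entering: "B \<subseteq> A \<Longrightarrow> finite (entering B X)"
  using finite_subset[OF _ finite_A] by (auto simp: entering_def)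

text \<open>An arc entering the intersection or the union enters \<open>X\<close> or
  \<open>Y\<close>, and an arc entering both the intersection and the union enters both
  \<open>X\<close> and \<open>Y\<close>.\<close>

lemma card_entering_submodular:
  assumes "B \<subseteq> A"
  shows "card (entering B (X \<inter> Y)) + card (entering B (X \<union> Y))
    \<le> card (entering B X) + card (entering B Y)"
proof -
  note fin = finite_entering[OF assms]
  have "card (entering B (X \<inter> Y)) + card (entering B (X \<union> Y))
      = card (entering B (X \<inter> Y) \<union> entering B (X \<union> Y))
        + card (entering B (X \<inter> Y) \<inter> entering B (X \<union> Y))"
    by (rule card_Un_Int) (use fin in auto)
  also have "\<dots> \<le> card (entering B X \<union> entering B Y) + card (entering B X \<inter> entering B Y)"
    by (intro add_mono card_mono) (use fin in \<open>auto simp: entering_def\<close>)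
  also have "\<dots> = card (entering B X) + card (entering B Y)"
    by (rule card_Un_Int[symmetric]) (use fin in auto)
  finally show ?thesis .
qed

text \<open>
  The cut condition of Edmonds' disjoint branchings theorem, where \<open>U\<close> is the set that a partially
  grown first branching already spans and \<open>B\<close> the set of arcs left. Following Lovasz, an arc from \<open>U\<close>
  to its complement can be added as long as it enters no critical set.
\<close>
definition edmonds_cond :: "'e set \<Rightarrow> 'v set \<Rightarrow> 'v set \<Rightarrow> bool" where
  "edmonds_cond B U R \<longleftrightarrow> (\<forall>X \<subseteq> V. X \<noteq> {} \<longrightarrow>
     of_bool (X \<inter> U = {}) + of_bool (X \<inter> R = {}) \<le> card (entering B X))"

lemma edmonds_condD:
  "edmonds_cond B U R \<Longrightarrow> X \<subseteq> V \<Longrightarrow> X \<noteq> {} \<Longrightarrow>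
    of_bool (X \<inter> U = {}) + of_bool (X \<inter> R = {}) \<le> card (entering B X)"
  by (simp add: edmonds_cond_def)

text \<open>Under \<open>edmonds_cond\<close> such a set demands one arc on behalf of
  \<open>R\<close> and is entered by exactly one, so losing that arc would violate the condition.
  The part outside \<open>U\<close> is where the head of a newly added arc lies.\<close>

definition critical :: "'e set \<Rightarrow> 'v set \<Rightarrow> 'v set \<Rightarrow> 'v set \<Rightarrow> bool" where
  "critical B U R X \<longleftrightarrow>
     X \<subseteq> V \<and> X \<inter> U \<noteq> {} \<and> X - U \<noteq> {} \<and> X \<inter> R = {} \<and> card (entering B X) \<le> 1"

text \<open>Only a set \<open>Y\<close> entered by \<open>a\<close> loses an arc. If
  \<open>Y\<close> avoids \<open>U\<close>, its demand drops by one too, because \<open>h a\<close>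
  joins \<open>U\<close>. If \<open>Y\<close> meets both \<open>U\<close> and \<open>R\<close>, it
  demands nothing. If it meets \<open>U\<close> but not \<open>R\<close>, it demands one arc and,
  not being critical, is entered by at least two.\<close>

lemma edmonds_cond_delete:
  assumes cond: "edmonds_cond B U R" and B: "B \<subseteq> A" and a: "a \<in> B" "h a \<notin> U"
    and safe: "\<And>Y. critical B U R Y \<Longrightarrow> a \<notin> entering B Y"
  shows "edmonds_cond (B - {a}) (insert (h a) U) R"
  unfolding edmonds_cond_def
proof (intro allI impI)
  fix Y assume Y: "Y \<subseteq> V" "Y \<noteq> {}"
  note c = edmonds_condD[OF cond Y]
  have e: "entering (B - {a}) Y = entering B Y - {a}" by (auto simp: entering_def)
  show "of_bool (Y \<inter> insert (h a) U = {}) + of_bool (Y \<inter> R = {}) \<le> card (entering (B - {a}) Y)"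
  proof (cases "a \<in> entering B Y")
    case False
    then have "entering (B - {a}) Y = entering B Y" using e by simp
    then show ?thesis using c by (auto simp: of_bool_def split: if_splits)
  next
    case True
    then have hY: "h a \<in> Y" by (simp add: entering_def)
    have "card (entering (B - {a}) Y) = card (entering B Y) - 1"
      using e True finite_entering[OF B] by simp
    moreover have "card (entering B Y) \<ge> 1"
      using True finite_entering[OF B, of Y] by (metis One_nat_def Suc_leI card_gt_0_iff empty_iff)
    moreover have "\<not> critical B U R Y" using safe True by blast
    ultimately show ?thesis using c hY a Y
      by (auto simp: of_bool_def critical_def split: if_splits)
  qed
qed

text \<open>Without critical sets, any arc entering the complement of \<open>U\<close> will do.
  Otherwise take a smallest critical \<open>X\<close>: its part outside \<open>U\<close> avoids both
  \<open>U\<close> and \<open>R\<close> and so is entered by at least two arcs, of which at most one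
  enters \<open>X\<close>. Another one stays inside \<open>X\<close> and touches \<open>U\<close>,
  and uncrossing shows that it enters no critical set.\<close>

lemma edmonds_step:
  assumes cond: "edmonds_cond B U R" and B: "B \<subseteq> A" and U: "U \<subseteq> V" "U \<noteq> V"
  obtains a where "a \<in> B" "h a \<notin> U" "en a \<inter> U \<noteq> {}"
    "edmonds_cond (B - {a}) (insert (h a) U) R"
proof (cases "\<exists>X. critical B U R X")
  case False
  have "card (entering B (V - U)) \<ge> 1"
    using edmonds_condD[OF cond, of "V - U"] U by (auto simp: Diff_Int_distrib2)
  then obtain a where a: "a \<in> entering B (V - U)" by (metis card.empty ex_in_conv not_one_le_zero)
  then have "a \<in> B" "h a \<notin> U" "en a \<inter> U \<noteq> {}"
    using en_subset_V B by (auto simp: entering_def)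
  then show ?thesis using that edmonds_cond_delete[OF cond B] False by metis
next
  case True
  then obtain X where X: "critical B U R X"
    and min: "\<And>Y. critical B U R Y \<Longrightarrow> card X \<le> card Y"
    using ex_has_least_nat[of "critical B U R" _ card] by metis
  have finX: "finite X" using X finite_V finite_subset unfolding critical_def by blast
  have "X - U \<subseteq> V" "X - U \<noteq> {}" "(X - U) \<inter> U = {}" "(X - U) \<inter> R = {}"
    using X unfolding critical_def by blast+
  then have "card (entering B (X - U)) \<ge> 2"
    using edmonds_condD[OF cond, of "X - U"] by simp
  then have "\<not> entering B (X - U) \<subseteq> entering B X"
    using X card_mono[OF finite_entering[OF B], of "entering B (X - U)" X]
    by (auto simp: critical_def)
  then obtain a where a: "a \<in> B" "h a \<in> X - U" "en a \<subseteq> X" "en a \<inter> U \<noteq> {}"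
    by (auto simp: entering_def)
  have "a \<notin> entering B Y" if Y: "critical B U R Y" for Y
  proof
    assume aY: "a \<in> entering B Y"
    have hXY: "h a \<in> X \<inter> Y" using a aY by (auto simp: entering_def)
    have XY: "X \<subseteq> V" "Y \<subseteq> V" "X \<inter> R = {}" "Y \<inter> R = {}" "X \<inter> U \<noteq> {}"
      "card (entering B X) \<le> 1" "card (entering B Y) \<le> 1"
      using X Y by (simp_all add: critical_def)
    \<comment> \<open>Uncrossing: intersection and union avoid \<open>R\<close> and demand one arc
      each, so by submodularity exactly one arc enters each. An intersection avoiding
      \<open>U\<close> would demand two; hence it meets \<open>U\<close> and is critical. It is
      smaller than \<open>X\<close>, as \<open>a\<close> has an endpoint in \<open>X\<close> outside
      \<open>Y\<close>.\<close>
    then have R: "(X \<union> Y) \<inter> R = {}" "(X \<inter> Y) \<inter> R = {}" by blast+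
    have "X \<union> Y \<subseteq> V" "X \<union> Y \<noteq> {}" "X \<inter> Y \<subseteq> V" "X \<inter> Y \<noteq> {}" using XY hXY by blast+
    note edmonds_condD[OF cond this(1,2)] edmonds_condD[OF cond this(3,4)]
    then have "of_bool (X \<inter> Y \<inter> U = {}) + 1 \<le> card (entering B (X \<inter> Y))"
      "1 \<le> card (entering B (X \<union> Y))"
      unfolding R by simp_all
    then have "X \<inter> Y \<inter> U \<noteq> {}" "card (entering B (X \<inter> Y)) \<le> 1"
      using card_entering_submodular[OF B, of X Y] XY(6,7)
      by (auto simp: of_bool_def split: if_splits)
    then have "critical B U R (X \<inter> Y)"
      using R(2) XY(1) hXY a(2) unfolding critical_def by blast
    moreover have "X \<inter> Y \<subset> X" using a aY by (auto simp: entering_def)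
    ultimately show False using min psubset_card_mono[OF finX] leD by blast
  qed
  then show ?thesis using that a edmonds_cond_delete[OF cond B] by blast
qed

text \<open>Each step moves one arc into the first branching and its head into \<open>U\<close>; the
  induction is on the number of vertices outside \<open>U\<close>. A set avoiding \<open>U\<close>
  is entered by the new arc \<open>a\<close> if it contains \<open>h a\<close>, since
  \<open>a\<close> touches \<open>U\<close>, and otherwise by the arcs added later.\<close>

lemma edmonds_grow:
  assumes "edmonds_cond B U R" "B \<subseteq> A" "U \<subseteq> V"
  shows "\<exists>C \<subseteq> B. branching C U \<and> edmonds_cond (B - C) V R"
  using assms
proof (induction "card (V - U)" arbitrary: B U)
  case 0
  then have "U = V" using finite_V by auto
  then show ?case using 0
    by (intro exI[of _ "{}"]) (auto simp: branching_def)
next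
  case (Suc n)
  have "U \<noteq> V" using Suc.hyps(2) by auto
  then obtain a where a: "a \<in> B" "h a \<notin> U" "en a \<inter> U \<noteq> {}"
    and cond: "edmonds_cond (B - {a}) (insert (h a) U) R"
    using edmonds_step[OF Suc.prems] by metis
  have haV: "h a \<in> V" using a Suc.prems h_in_V by auto
  have "V - U = insert (h a) (V - insert (h a) U)" using haV a by auto
  then have "n = card (V - insert (h a) U)"
    using Suc.hyps(2) finite_V by (metis DiffE card_insert_disjoint finite_Diff insertI1 nat.inject)
  then obtain C where C: "C \<subseteq> B - {a}" "branching C (insert (h a) U)"
    and C2: "edmonds_cond (B - {a} - C) V R"
    using Suc.hyps(1)[OF _ cond] Suc.prems haV by blast
  have finC: "finite C" using C Suc.prems finite_A finite_subset by (metis Diff_subset subset_trans)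
  have "branching (insert a C) U"
    unfolding branching_def
  proof (intro conjI ballI allI impI)
    fix v assume v: "v \<in> V"
    have c: "card {x \<in> C. h x = v} = of_bool (v \<notin> insert (h a) U)"
      using C v by (auto simp: branching_def)
    show "card {x \<in> insert a C. h x = v} = of_bool (v \<notin> U)"
    proof (cases "v = h a")
      case True
      have "{x \<in> C. h x = v} = {}" using c True finC by simp
      then have "{x \<in> insert a C. h x = v} = {a}" using True by auto
      then show ?thesis using True a by simp
    next
      case False
      then have "{x \<in> insert a C. h x = v} = {x \<in> C. h x = v}" by auto
      then show ?thesis using c False by simp
    qed
  next
    fix X assume X: "X \<subseteq> V" "X \<noteq> {}" "X \<inter> U = {}"
    show "entering (insert a C) X \<noteq> {}"
    proof (cases "h a \<in> X")
      case True
      then have "a \<in> entering (insert a C) X" using a X by (auto simp: entering_def)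
      then show ?thesis by blast
    next
      case False
      then have "entering C X \<noteq> {}" using C X by (auto simp: branching_def)
      then show ?thesis by (auto simp: entering_def)
    qed
  qed (use C a Suc.prems in auto)
  moreover have "B - insert a C = B - {a} - C" by auto
  ultimately show ?case using C C2 a by (intro exI[of _ "insert a C"]) auto
qed

text \<open>With \<open>V\<close> in the place of \<open>U\<close>, the condition that
  \<open>edmonds_grow\<close> leaves for the remaining arcs is the last conjunct of
  \<open>branching\<close>; their indegrees follow by subtraction from the prescribed ones.\<close>

lemma edmonds_two_branchings:
  assumes cond: "edmonds_cond A R S" and R: "R \<subseteq> V" "S \<subseteq> V"
    and deg: "\<And>v. v \<in> V \<Longrightarrow> card {a \<in> A. h a = v} = of_bool (v \<notin> R) + of_bool (v \<notin> S)"
  obtains B C where "branching B R" "branching C S" "B \<union> C = A" "B \<inter> C = {}"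
proof -
  obtain B where B: "B \<subseteq> A" "branching B R" "edmonds_cond (A - B) V S"
    using edmonds_grow[OF cond] R by blast
  have "branching (A - B) S"
    unfolding branching_def
  proof (intro conjI ballI allI impI)
    fix v assume v: "v \<in> V"
    have "{a \<in> A - B. h a = v} = {a \<in> A. h a = v} - {a \<in> B. h a = v}" by auto
    moreover have "card \<dots> = card {a \<in> A. h a = v} - card {a \<in> B. h a = v}"
      using B finite_subset[OF B(1) finite_A] by (intro card_Diff_subset) auto
    ultimately show "card {a \<in> A - B. h a = v} = of_bool (v \<notin> S)"
      using deg[OF v] B v by (auto simp: branching_def)
  next
    fix X assume "X \<subseteq> V" "X \<noteq> {}" "X \<inter> S = {}"
    then have "card (entering (A - B) X) \<ge> 1"
      using edmonds_condD[OF B(3), of X] by auto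
    then show "entering (A - B) X \<noteq> {}" by auto
  qed (use R in auto)
  then show ?thesis using that B by blast
qed

lemma card_fibres_branching_union:
  assumes "branching B R" "branching C S" "B \<union> C = A" "B \<inter> C = {}" "v \<in> V"
  shows "card {a \<in> A. h a = v} = of_bool (v \<notin> R) + of_bool (v \<notin> S)"
proof -
  have "{a \<in> A. h a = v} = {a \<in> B. h a = v} \<union> {a \<in> C. h a = v}" using assms(3) by blast
  moreover have "finite {a \<in> B. h a = v}" "finite {a \<in> C. h a = v}"
    using assms(3) finite_A by auto
  moreover have "{a \<in> B. h a = v} \<inter> {a \<in> C. h a = v} = {}" using assms(4) by blast
  ultimately have "card {a \<in> A. h a = v} = card {a \<in> B. h a = v} + card {a \<in> C. h a = v}"
    by (simp add: card_Un_disjoint)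
  then show ?thesis using assms(1,2,5) by (simp add: branching_def)
qed

text \<open>
  The pairs come from the minimal sets that no arc enters (the source components): a swap may be
  completed to branchings as long as each of these keeps a root of both kinds.
\<close>
lemma branching_exchange:
  assumes BC: "branching B R" "branching C S" "B \<union> C = A" "B \<inter> C = {}"
  obtains N where
    "\<And>p. p \<in> N \<Longrightarrow> \<exists>r \<in> R - S. \<exists>s \<in> S - R. p = {r, s}"
    "disjoint N"
    "\<And>Z. (\<And>p. p \<in> N \<Longrightarrow> p \<subseteq> Z \<or> p \<inter> Z = {}) \<Longrightarrow>
      \<exists>B' C'. branching B' (R - Z \<union> S \<inter> Z) \<and> branching C' (S - Z \<union> R \<inter> Z) \<and>
        B' \<union> C' = A \<and> B' \<inter> C' = {}"
proof -
  define closed where "closed K \<longleftrightarrow> K \<subseteq> V \<and> K \<noteq> {} \<and> entering A K = {}" for K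
  \<comment> \<open>These are the source components. Two closed sets that meet have a closed
    intersection, so distinct source components are disjoint.\<close>
  define src where "src K \<longleftrightarrow> closed K \<and> (\<forall>L. closed L \<longrightarrow> L \<subseteq> K \<longrightarrow> L = K)" for K
  have RS: "R \<subseteq> V" "S \<subseteq> V" using BC by (auto simp: branching_def)
  have src_below: "\<exists>K \<subseteq> X. src K" if "closed X" for X
  proof -
    define F where "F = {K. closed K \<and> K \<subseteq> X}"
    have "finite F"
      by (rule finite_subset[of _ "Pow V"]) (use finite_V in \<open>auto simp: F_def closed_def\<close>)
    moreover have "F \<noteq> {}" using that by (auto simp: F_def)
    ultimately obtain K where "K \<in> F" and min: "\<forall>L \<in> F. L \<subseteq> K \<longrightarrow> K = L"
      using finite_has_minimal[of F] by auto
    then have K: "closed K" "K \<subseteq> X" by (auto simp: F_def)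
    have "src K" unfolding src_def
      using K min by (auto simp: F_def)
    then show ?thesis using K by blast
  qed
  have src_disjoint: "K \<inter> L = {}" if "src K" "src L" "K \<noteq> L" for K L
  proof (rule ccontr)
    assume "K \<inter> L \<noteq> {}"
    then have "closed (K \<inter> L)"
      using that by (auto simp: src_def closed_def entering_def)
    then show False using that by (metis inf_le1 inf_le2 src_def)
  qed
  have src_meets: "K \<inter> T \<noteq> {}" if "src K" "branching D T" "D \<subseteq> A" for K D T
  proof
    assume "K \<inter> T = {}"
    then have "entering D K \<noteq> {}" using that by (simp add: src_def closed_def branching_def)
    then have "entering A K \<noteq> {}" using that(3) by (auto simp: entering_def)
    then show False using that(1) by (simp add: src_def closed_def)
  qed
  \<comment> \<open>Nothing enters a source component, so both branchings have a root in it; if no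
    root is common, these roots lie in \<open>R - S\<close> and \<open>S - R\<close>.\<close>
  have "\<exists>r s. r \<in> K \<inter> (R - S) \<and> s \<in> K \<inter> (S - R)" if "src K" "K \<inter> R \<inter> S = {}" for K
    using src_meets[OF that(1) BC(1)] src_meets[OF that(1) BC(2)] that(2) BC(3) by blast
  then obtain r s where rs:
    "\<And>K. src K \<Longrightarrow> K \<inter> R \<inter> S = {} \<Longrightarrow> r K \<in> K \<inter> (R - S) \<and> s K \<in> K \<inter> (S - R)"
    by metis
  define N where "N = (\<lambda>K. {r K, s K}) ` {K. src K \<and> K \<inter> R \<inter> S = {}}"
  show ?thesis
  proof (rule that[of N])
    show "\<exists>r \<in> R - S. \<exists>s \<in> S - R. p = {r, s}" if "p \<in> N" for p
      using that rs unfolding N_def by blast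
    show "disjoint N"
    proof (rule disjointI)
      fix p q assume "p \<in> N" "q \<in> N" "p \<noteq> q"
      then obtain K L where KL: "src K" "src L" "K \<noteq> L" "p \<subseteq> K" "q \<subseteq> L"
        unfolding N_def using rs by blast
      then show "p \<inter> q = {}" using src_disjoint[OF KL(1-3)] by blast
    qed
  next
    fix Z assume Z: "\<And>p. p \<in> N \<Longrightarrow> p \<subseteq> Z \<or> p \<inter> Z = {}"
    define R' where "R' = R - Z \<union> S \<inter> Z"
    define S' where "S' = S - Z \<union> R \<inter> Z"
    have "edmonds_cond A R' S'"
      unfolding edmonds_cond_def
    proof (intro allI impI)
      fix X assume X: "X \<subseteq> V" "X \<noteq> {}"
      \<comment> \<open>Exchanging on \<open>Z\<close> keeps every common root and the union of the
        two root sets. The three cases demand no arc, at most one arc and at most two arcs; the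
        first is where the pairs in \<open>N\<close> are used.\<close>
      consider "entering A X = {}" | "entering A X \<noteq> {}" "X \<inter> (R \<union> S) \<noteq> {}"
        | "X \<inter> R = {}" "X \<inter> S = {}"
        by blast
      then show "of_bool (X \<inter> R' = {}) + of_bool (X \<inter> S' = {}) \<le> card (entering A X)"
      proof cases
        case 1
        then obtain K where K: "K \<subseteq> X" "src K" using src_below[of X] X by (auto simp: closed_def)
        have "K \<inter> R' \<noteq> {} \<and> K \<inter> S' \<noteq> {}"
        proof (cases "K \<inter> R \<inter> S = {}")
          case True
          then have "{r K, s K} \<in> N" using K by (auto simp: N_def)
          then show ?thesis using Z rs[OF K(2) True] unfolding R'_def S'_def by blast
        qed (auto simp: R'_def S'_def)
        then have "X \<inter> R' \<noteq> {}" "X \<inter> S' \<noteq> {}" using K by blast+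
        then show ?thesis by simp
      next
        case 2
        then have "X \<inter> R' \<noteq> {} \<or> X \<inter> S' \<noteq> {}" by (auto simp: R'_def S'_def)
        moreover have "card (entering A X) \<ge> 1"
          using 2 finite_entering[of A X] by (simp add: Suc_leI card_gt_0_iff)
        ultimately show ?thesis by auto
      next
        case 3
        then have "entering B X \<noteq> {}" "entering C X \<noteq> {}" using BC X by (auto simp: branching_def)
        moreover have "entering A X = entering B X \<union> entering C X" "entering B X \<inter> entering C X = {}"
          using BC by (auto simp: entering_def)
        moreover have "finite (entering B X)" "finite (entering C X)"
          using BC by (auto simp: branching_def intro: finite_entering)
        ultimately have "card (entering A X) \<ge> 1 + 1"
          by (metis add_mono card_Un_disjoint card_0_eq less_one not_le)
        then show ?thesis by (auto simp: of_bool_def)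
      qed
    qed
    moreover have "card {a \<in> A. h a = v} = of_bool (v \<notin> R') + of_bool (v \<notin> S')" if "v \<in> V" for v
      using card_fibres_branching_union[OF BC that] by (auto simp: R'_def S'_def)
    moreover have "R' \<subseteq> V" "S' \<subseteq> V" using RS by (auto simp: R'_def S'_def)
    ultimately obtain B' C' where "branching B' R'" "branching C' S'" "B' \<union> C' = A" "B' \<inter> C' = {}"
      using edmonds_two_branchings[of R' S'] by blast
    then show "\<exists>B' C'. branching B' (R - Z \<union> S \<inter> Z) \<and> branching C' (S - Z \<union> R \<inter> Z) \<and>
        B' \<union> C' = A \<and> B' \<inter> C' = {}"
      unfolding R'_def S'_def by blast
  qed
qed

text \<open>Each vertex outside \<open>R\<close> is the head of exactly one arc of \<open>B\<close>.
  Differences of arc counts thus become differences of root counts with the opposite sign.\<close>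

lemma card_branching:
  assumes "branching B R"
  shows "card B + card R = card V"
proof -
  have B: "B \<subseteq> A" "finite B" using assms finite_A finite_subset by (auto simp: branching_def)
  have "card B = card (\<Union>v \<in> V. {a \<in> B. h a = v})"
    using B h_in_V by (intro arg_cong[of _ _ card]) auto
  also have "\<dots> = (\<Sum>v \<in> V. card {a \<in> B. h a = v})"
    using B finite_V by (intro card_UN_disjoint) auto
  also have "\<dots> = (\<Sum>v \<in> V. of_bool (v \<in> V - R))"
    using assms by (intro sum.cong) (auto simp: branching_def)
  also have "\<dots> = card (V - R)"
    using finite_V by (simp add: Int_absorb1 del: of_bool_conj Diff_iff)
  finally show ?thesis
    using assms finite_V card_Diff_subset[of R V] card_mono[of V R] finite_subset[of R V]
    by (auto simp: branching_def)
qed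

end

section \<open>Components and signs\<close>

text \<open>The blocks are the connected components, built from singletons by inserting one edge at
  a time. An edge between two blocks merges them, and this new edge makes up for the second
  \<open>Suc\<close> when the two bounds are added. The bound is the number of edges of a spanning
  tree.\<close>

lemma component_partition:
  fixes en :: "'x \<Rightarrow> 'v set"
  assumes V: "finite V" and E: "finite E" "\<And>e. e \<in> E \<Longrightarrow> en e \<subseteq> V \<and> card (en e) = 2"
  shows "\<exists>\<P>. partition_on V \<P> \<and> (\<forall>e \<in> E. \<exists>P \<in> \<P>. en e \<subseteq> P) \<and>
    (\<forall>P \<in> \<P>. card P \<le> Suc (card {e \<in> E. en e \<subseteq> P}))"
  using E
proof (induction E rule: finite_induct)
  case empty
  have "partition_on V ((\<lambda>v. {v}) ` V)" by (auto simp: partition_on_def disjoint_def)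
  then show ?case by (intro exI[of _ "(\<lambda>v. {v}) ` V"]) auto
next
  case (insert e E)
  then obtain \<P> where P: "partition_on V \<P>" "\<forall>e \<in> E. \<exists>P \<in> \<P>. en e \<subseteq> P"
    and bd: "\<And>P. P \<in> \<P> \<Longrightarrow> card P \<le> Suc (card {e \<in> E. en e \<subseteq> P})"
    by auto
  have bd': "card P \<le> Suc (card {e' \<in> insert e E. en e' \<subseteq> P})" if "P \<in> \<P>" for P
    using bd[OF that] card_mono[of "{e' \<in> insert e E. en e' \<subseteq> P}" "{e \<in> E. en e \<subseteq> P}"]
      insert.hyps by fastforce
  obtain x y where xy: "en e = {x, y}" using insert.prems by (metis card_2_iff insertI1)
  have "x \<in> V" "y \<in> V" using insert.prems[of e] xy by auto
  then obtain X Y where XY: "X \<in> \<P>" "Y \<in> \<P>" "x \<in> X" "y \<in> Y"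
    using P(1) by (auto simp: partition_on_def)
  show ?case
  proof (cases "X = Y")
    case True
    then show ?thesis using P bd' XY xy by (intro exI[of _ \<P>]) auto
  next
    case False
    then have disj: "X \<inter> Y = {}" using P(1) XY by (auto simp: partition_on_def disjoint_def)
    let ?Q = "insert (X \<union> Y) (\<P> - {X, Y})"
    let ?in = "\<lambda>P. {e \<in> E. en e \<subseteq> P}"
    have merged: "card (X \<union> Y) \<le> Suc (card {e' \<in> insert e E. en e' \<subseteq> X \<union> Y})"
    proof -
      have nonempty: "en f \<noteq> {}" if "f \<in> E" for f using insert.prems[of f] that by auto
      have "?in X \<inter> ?in Y = {}" using nonempty disj by blast
      then have "card (insert e (?in X \<union> ?in Y)) = Suc (card (?in X) + card (?in Y))"
        using insert.hyps by (simp add: card_Un_disjoint)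
      moreover have "card (insert e (?in X \<union> ?in Y)) \<le> card {e' \<in> insert e E. en e' \<subseteq> X \<union> Y}"
        using insert.hyps XY xy by (intro card_mono) auto
      ultimately show ?thesis
        using bd[OF XY(1)] bd[OF XY(2)] card_Un_le[of X Y] by linarith
    qed
    have "partition_on V ?Q"
    proof (rule partition_onI)
      show "\<Union> ?Q = V" using P(1) XY by (auto simp: partition_on_def)
      show "disjnt p q" if "p \<in> ?Q" "q \<in> ?Q" "p \<noteq> q" for p q
        using that P(1) XY unfolding partition_on_def disjoint_def disjnt_def by auto
      show "{} \<notin> ?Q" using P(1) XY by (auto simp: partition_on_def)
    qed
    moreover have "\<exists>P \<in> ?Q. en f \<subseteq> P" if "f \<in> insert e E" for f
    proof -
      have "en e \<subseteq> X \<union> Y" using XY xy by simp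
      moreover obtain P where "P \<in> \<P>" "en f \<subseteq> P" if "f \<in> E" using P(2) by metis
      ultimately show ?thesis using that by (cases "f = e"; cases "P = X \<or> P = Y") auto
    qed
    ultimately show ?thesis using bd' merged by (intro exI[of _ ?Q]) auto
  qed
qed

text \<open>
  Assigning the signs greedily works if the elements with \<open>m\<close> and \<open>f\<close> both nonzero come first, then
  those with \<open>m = 0\<close>, and then those with \<open>f = 0\<close>.
\<close>
lemma balancing_signs:
  fixes m f :: "'p \<Rightarrow> int"
  assumes C: "finite C" and bd: "\<And>p. p \<in> C \<Longrightarrow> \<bar>m p\<bar> \<le> 1 \<and> \<bar>f p\<bar> \<le> 1"
  obtains s :: "'p \<Rightarrow> int" where "\<And>p. s p \<in> {1, -1}"
    "\<bar>\<Sum>p \<in> C. s p * m p\<bar> \<le> 1" "\<bar>\<Sum>p \<in> C. s p * f p\<bar> \<le> 2"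
    "\<bar>(\<Sum>p \<in> C. s p * f p) - (\<Sum>p \<in> C. s p * m p)\<bar> \<le> 2"
proof -
  \<comment> \<open>The greedy choice for an arbitrary invariant \<open>I'\<close> of the two
    partial sums, applied to each of the three classes in turn.\<close>
  have step: "\<exists>s. (\<forall>p. s p \<in> {1, -1}) \<and> I' (\<Sum>p \<in> D \<union> X. s p * m p) (\<Sum>p \<in> D \<union> X. s p * f p)"
    if "finite X" "finite D" "D \<inter> X = {}"
      "\<exists>s. (\<forall>p. s p \<in> {1, -1}) \<and> I' (\<Sum>p \<in> D. s p * m p) (\<Sum>p \<in> D. s p * f p)"
      "\<And>a b p. p \<in> X \<Longrightarrow> I' a b \<Longrightarrow> I' (a + m p) (b + f p) \<or> I' (a - m p) (b - f p)"
    for X D and I' :: "int \<Rightarrow> int \<Rightarrow> bool"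
    using that
  proof (induction X rule: finite_induct)
    case empty
    then show ?case by simp
  next
    case (insert x X)
    then obtain s where s: "\<forall>p. s p \<in> {1, -1}"
      and I: "I' (\<Sum>p \<in> D \<union> X. s p * m p) (\<Sum>p \<in> D \<union> X. s p * f p)" by auto
    obtain t :: int where t: "t \<in> {1, -1}"
      and I2: "I' ((\<Sum>p \<in> D \<union> X. s p * m p) + t * m x) ((\<Sum>p \<in> D \<union> X. s p * f p) + t * f x)"
    proof -
      consider "I' ((\<Sum>p \<in> D \<union> X. s p * m p) + m x) ((\<Sum>p \<in> D \<union> X. s p * f p) + f x)"
        | "I' ((\<Sum>p \<in> D \<union> X. s p * m p) - m x) ((\<Sum>p \<in> D \<union> X. s p * f p) - f x)"
        using insert.prems(4)[OF _ I, of x] by blast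
      then show thesis
      proof cases
        case 1
        then show ?thesis using that[of 1] by simp
      next
        case 2
        then show ?thesis using that[of "-1"] by simp
      qed
    qed
    have x: "x \<notin> D \<union> X" "finite (D \<union> X)" using insert by auto
    have "(\<Sum>p \<in> insert x (D \<union> X). (s(x := t)) p * g p) = (\<Sum>p \<in> D \<union> X. s p * g p) + t * g x"
      for g :: "'p \<Rightarrow> int"
    proof -
      have "(\<Sum>p \<in> D \<union> X. (s(x := t)) p * g p) = (\<Sum>p \<in> D \<union> X. s p * g p)"
        using x by (intro sum.cong) auto
      then show ?thesis using x by simp
    qed
    then show ?case using s t I2 by (intro exI[of _ "s(x := t)"]) auto
  qed
  define C1 where "C1 = {p \<in> C. m p \<noteq> 0 \<and> f p \<noteq> 0}"
  define C2 where "C2 = {p \<in> C. m p = 0}"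
  define C3 where "C3 = {p \<in> C. m p \<noteq> 0 \<and> f p = 0}"
  have fin: "finite C1" "finite C2" "finite C3" using C by (auto simp: C1_def C2_def C3_def)
  have disj: "{} \<inter> C1 = {}" "({} \<union> C1) \<inter> C2 = {}" "(({} \<union> C1) \<union> C2) \<inter> C3 = {}"
    by (auto simp: C1_def C2_def C3_def)
  have C_eq: "(({} \<union> C1) \<union> C2) \<union> C3 = C" by (auto simp: C1_def C2_def C3_def)
  \<comment> \<open>For \<open>I1\<close>, the sign cancels \<open>a\<close> if it is nonzero, and
    otherwise pulls \<open>b\<close> back towards 0. For \<open>I2\<close>, only \<open>b\<close>
    moves, and it moves towards 0 unless it is 0 already. For \<open>I3\<close>, only
    \<open>a\<close> moves: back to 0 if nonzero, and otherwise to the side of \<open>b\<close>.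
    Each invariant implies the next.\<close>
  define I1 where "I1 a b \<longleftrightarrow> (\<bar>a\<bar> = 1 \<and> \<bar>b\<bar> = 1) \<or> (a = 0 \<and> (b = 0 \<or> \<bar>b\<bar> = 2))"
    for a b :: int
  define I2 where "I2 a b \<longleftrightarrow> \<bar>a\<bar> \<le> 1 \<and> \<bar>a\<bar> + \<bar>b\<bar> \<le> 2" for a b :: int
  define I3 where "I3 a b \<longleftrightarrow> \<bar>a\<bar> \<le> 1 \<and> \<bar>b\<bar> \<le> 2 \<and> \<bar>b - a\<bar> \<le> 2" for a b :: int
  have unit: "m p \<in> {-1, 0, 1}" "f p \<in> {-1, 0, 1}" if "p \<in> C" for p
    using bd[OF that] by auto
  have "I1 (a + m p) (b + f p) \<or> I1 (a - m p) (b - f p)" if "p \<in> C1" "I1 a b" for a b p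
  proof -
    have "\<bar>m p\<bar> = 1" "\<bar>f p\<bar> = 1" using that(1) unit[of p] by (auto simp: C1_def)
    then show ?thesis using that(2) unfolding I1_def by (smt (verit))
  qed
  then have "\<exists>s. (\<forall>p. s p \<in> {1, -1}) \<and>
      I1 (\<Sum>p \<in> {} \<union> C1. s p * m p) (\<Sum>p \<in> {} \<union> C1. s p * f p)"
    by (intro step[OF fin(1) _ disj(1)]) (auto simp: I1_def)
  then have "\<exists>s. (\<forall>p. s p \<in> {1, -1}) \<and>
      I2 (\<Sum>p \<in> {} \<union> C1. s p * m p) (\<Sum>p \<in> {} \<union> C1. s p * f p)"
    by (rule ex_forward) (auto simp: I1_def I2_def)
  moreover have "I2 (a + m p) (b + f p) \<or> I2 (a - m p) (b - f p)" if "p \<in> C2" "I2 a b" for a b p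
  proof -
    have "m p = 0" "\<bar>f p\<bar> \<le> 1" using that(1) bd[of p] by (auto simp: C2_def)
    then show ?thesis using that(2) unfolding I2_def by (smt (verit))
  qed
  ultimately have "\<exists>s. (\<forall>p. s p \<in> {1, -1}) \<and>
      I2 (\<Sum>p \<in> ({} \<union> C1) \<union> C2. s p * m p) (\<Sum>p \<in> ({} \<union> C1) \<union> C2. s p * f p)"
    using fin by (intro step[OF fin(2) _ disj(2)]) auto
  then have "\<exists>s. (\<forall>p. s p \<in> {1, -1}) \<and>
      I3 (\<Sum>p \<in> ({} \<union> C1) \<union> C2. s p * m p) (\<Sum>p \<in> ({} \<union> C1) \<union> C2. s p * f p)"
    by (rule ex_forward) (auto simp: I2_def I3_def)
  moreover have "I3 (a + m p) (b + f p) \<or> I3 (a - m p) (b - f p)" if "p \<in> C3" "I3 a b" for a b p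
  proof -
    have "\<bar>m p\<bar> = 1" "f p = 0" using that(1) unit[of p] by (auto simp: C3_def)
    then show ?thesis using that(2) unfolding I3_def by (smt (verit))
  qed
  ultimately have "\<exists>s. (\<forall>p. s p \<in> {1, -1}) \<and>
      I3 (\<Sum>p \<in> (({} \<union> C1) \<union> C2) \<union> C3. s p * m p) (\<Sum>p \<in> (({} \<union> C1) \<union> C2) \<union> C3. s p * f p)"
    using fin by (intro step[OF fin(3) _ disj(3)]) auto
  then show ?thesis using that unfolding C_eq I3_def by blast
qed

text \<open>
  The weight 3 on the squared edge counts makes up for the at most \<open>8\<close> that the other two squared
  differences can amount to after rebalancing, since a difference \<open>m - n\<close> of at least 2 drops to at
  most 1.
\<close>
lemma sum_squares_decrease:
  fixes b b' c c' m m' n n' :: int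
  assumes "m + n = m' + n'" "b + c = b' + c'"
    and "\<bar>m' - n'\<bar> \<le> 1" "\<bar>(m' + b') - (n' + c')\<bar> \<le> 2" "\<bar>b' - c'\<bar> \<le> 2"
    and "\<not> (\<bar>m - n\<bar> \<le> 1 \<and> \<bar>(m + b) - (n + c)\<bar> \<le> 2 \<and> \<bar>b - c\<bar> \<le> 2)"
  shows "3 * m'\<^sup>2 + b'\<^sup>2 + (m' + b')\<^sup>2 + (3 * n'\<^sup>2 + c'\<^sup>2 + (n' + c')\<^sup>2)
    < 3 * m\<^sup>2 + b\<^sup>2 + (m + b)\<^sup>2 + (3 * n\<^sup>2 + c\<^sup>2 + (n + c)\<^sup>2)"
proof -
  define x where "x = m - n"
  define y where "y = b - c"
  define x' where "x' = m' - n'"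
  define y' where "y' = b' - c'"
  have new: "\<bar>x'\<bar> \<le> 1" "\<bar>x' + y'\<bar> \<le> 2" "\<bar>y'\<bar> \<le> 2"
    using assms by (auto simp: x'_def y'_def)
  have old: "\<not> (\<bar>x\<bar> \<le> 1 \<and> \<bar>x + y\<bar> \<le> 2 \<and> \<bar>y\<bar> \<le> 2)"
    using assms(6) by (auto simp: x_def y_def algebra_simps)
  have sq: "k\<^sup>2 \<le> z\<^sup>2" if "0 \<le> k" "k \<le> \<bar>z\<bar>" for k z :: int
    using that by (simp add: abs_le_square_iff[symmetric])
  note sq2 = sq[of 2, simplified] and sq3 = sq[of 3, simplified]
  have "x' \<in> {-1, 0, 1}" "y' \<in> {-2, -1, 0, 1, 2}" using new by auto
  then have "3 * x'\<^sup>2 + y'\<^sup>2 + (x' + y')\<^sup>2 \<le> 11" using new by auto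
  \<comment> \<open>The three cases give at least \<open>3 * 4\<close>, \<open>9 + 4\<close> and
    \<open>4 + 9\<close>, against the bound \<open>3 + 8\<close> for the new differences.\<close>
  moreover have "12 \<le> 3 * x\<^sup>2 + y\<^sup>2 + (x + y)\<^sup>2"
  proof -
    consider "2 \<le> \<bar>x\<bar>" | "\<bar>x\<bar> \<le> 1" "3 \<le> \<bar>y\<bar>" | "\<bar>x\<bar> \<le> 1" "3 \<le> \<bar>x + y\<bar>" using old by linarith
    then show ?thesis
    proof cases
      case 1
      then show ?thesis
        using sq2[of x] zero_le_power2[of y] zero_le_power2[of "x + y"] by linarith
    next
      case 2
      then have "2 \<le> \<bar>x + y\<bar>" by linarith
      then show ?thesis using 2 sq3[of y] sq2[of "x + y"] zero_le_power2[of x] by linarith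
    next
      case 3
      then have "2 \<le> \<bar>y\<bar>" by linarith
      then show ?thesis using 3 sq2[of y] sq3[of "x + y"] zero_le_power2[of x] by linarith
    qed
  qed
  ultimately have lt: "3 * x'\<^sup>2 + y'\<^sup>2 + (x' + y')\<^sup>2 < 3 * x\<^sup>2 + y\<^sup>2 + (x + y)\<^sup>2" by linarith
  \<comment> \<open>Two squares add up to half the squared sum plus half the squared difference. The
    sums are preserved, so only the differences matter.\<close>
  have id: "2 * (3 * p\<^sup>2 + q\<^sup>2 + (p + q)\<^sup>2 + (3 * r\<^sup>2 + s\<^sup>2 + (r + s)\<^sup>2))
      = 3 * (p + r)\<^sup>2 + (q + s)\<^sup>2 + ((p + r) + (q + s))\<^sup>2
        + (3 * (p - r)\<^sup>2 + (q - s)\<^sup>2 + ((p - r) + (q - s))\<^sup>2)" for p q r s :: int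
    by (simp add: power2_eq_square algebra_simps)
  show ?thesis
    using lt id[of m b n c] id[of m' b' n' c'] assms(1,2)
    unfolding x_def y_def x'_def y'_def by simp
qed

section \<open>Matching forests\<close>

text \<open>\<open>A\<close> stands for the arcs of the two forests under exchange. It is finite
  because matching forests are, whereas \<open>wf_mixed_graph\<close> alone does not make
  \<open>arcs G\<close> finite.\<close>

locale mixed_graph_arcs =
  fixes G :: "('v, 'e) mixed_graph" and A :: "'e set"
  assumes wf: "wf_mixed_graph G" and finite_arcs: "finite A" and arcs_subset: "A \<subseteq> arcs G"

sublocale mixed_graph_arcs \<subseteq> directed_hypergraph "verts G" A "head G" "ends G"
  using wf finite_arcs arcs_subset by unfold_locales (auto simp: wf_mixed_graph_def; blast)+

section \<open>Matching forests as matchings on the roots of branchings\<close>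

context mixed_graph_arcs
begin

lemma ends_subset: "e \<in> edges G \<union> arcs G \<Longrightarrow> ends G e \<subseteq> verts G"
  and card_ends: "e \<in> edges G \<union> arcs G \<Longrightarrow> card (ends G e) = 2"
  and heads_edge: "e \<in> edges G \<Longrightarrow> heads G e = ends G e"
  and heads_arc: "e \<in> arcs G \<Longrightarrow> heads G e = {head G e}"
  and heads_subset: "e \<in> edges G \<union> arcs G \<Longrightarrow> heads G e \<subseteq> ends G e"
  using wf by (auto simp: wf_mixed_graph_def heads_def)

text \<open>Iterating \<open>p\<close> in the finite set \<open>X\<close> reaches a recurring
  vertex. Its least positive period gives a closed walk without repeated vertices, and the arcs of
  the walk are distinct because their heads are.\<close>

lemma cycle_of_parents:
  assumes X: "finite X" "X \<noteq> {}"
    and p: "\<And>v. v \<in> X \<Longrightarrow> p v \<in> X \<and> ends G (a v) = {v, p v} \<and> head G (a v) = v"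
  shows "\<exists>vs es. set es \<subseteq> a ` X \<and> is_cycle G vs es"
proof -
  obtain x where x: "x \<in> X" using X by auto
  have iter: "(p ^^ i) y \<in> X" if "y \<in> X" for i y using that p by (induction i) auto
  have "\<not> inj (\<lambda>i. (p ^^ i) x)"
    using X(1) iter[OF x] finite_subset[of "range (\<lambda>i. (p ^^ i) x)" X] finite_imageD infinite_UNIV_nat
    by blast
  then obtain i j where ij: "i < j" "(p ^^ i) x = (p ^^ j) x"
    unfolding inj_def by (metis linorder_neqE_nat)
  define y where "y = (p ^^ i) x"
  have y: "y \<in> X" using iter[OF x] by (simp add: y_def)
  have "(p ^^ (j - i)) y = y"
    using ij unfolding y_def by (metis add.commute comp_apply funpow_add le_add_diff_inverse less_imp_le)
  then have ex: "\<exists>n > 0. (p ^^ n) y = y" using ij(1) by (intro exI[of _ "j - i"]) simp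
  define n where "n = (LEAST n. n > 0 \<and> (p ^^ n) y = y)"
  have n: "n > 0" "(p ^^ n) y = y" using LeastI_ex[OF ex] unfolding n_def by blast+
  have least: "(p ^^ k) y \<noteq> y" if "0 < k" "k < n" for k
    using not_less_Least[of k "\<lambda>n. n > 0 \<and> (p ^^ n) y = y"] that unfolding n_def by blast
  \<comment> \<open>From \<open>(p ^^ l) y\<close> it takes \<open>n - l\<close> further steps back
    to \<open>y\<close>, so a coincidence would give the smaller period
    \<open>n - l + k\<close>.\<close>
  have inj: "(p ^^ k) y \<noteq> (p ^^ l) y" if "k < l" "l < n" for k l
  proof
    assume eq: "(p ^^ k) y = (p ^^ l) y"
    have "(p ^^ (n - l + k)) y = (p ^^ (n - l + l)) y" unfolding funpow_add comp_apply eq ..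
    also have "\<dots> = y" using that n(2) by simp
    finally have "(p ^^ (n - l + k)) y = y" .
    moreover have pos: "0 < n - l + k" and lt: "n - l + k < n" using that by linarith+
    ultimately show False using least[OF pos lt] by blast
  qed
  define vs where "vs = map (\<lambda>k. (p ^^ k) y) [0..<n]"
  have len: "length vs = n" by (simp add: vs_def)
  have "distinct vs"
    unfolding vs_def distinct_map
  proof (intro conjI inj_onI)
    fix k l assume "k \<in> set [0..<n]" "l \<in> set [0..<n]" "(p ^^ k) y = (p ^^ l) y"
    then show "k = l" using inj[of k l] inj[of l k] by (cases k l rule: linorder_cases) simp_all
  qed simp
  moreover have setvs: "set vs \<subseteq> X" using iter[OF y] by (auto simp: vs_def)
  ultimately have "distinct (map a vs)"
    unfolding distinct_map using p by (metis inj_onI subsetD)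
  moreover have "ends G (map a vs ! k) = {vs ! k, vs ! (Suc k mod length vs)}" if "k < n" for k
  proof -
    have "vs ! (Suc k mod length vs) = p (vs ! k)"
      using that n by (cases "Suc k = n") (auto simp: len vs_def)
    moreover have "vs ! k \<in> X" using that setvs len nth_mem by blast
    ultimately show ?thesis using that p[of "vs ! k"] len by simp
  qed
  ultimately have "is_cycle G vs (map a vs)"
    using \<open>distinct vs\<close> n(1) len unfolding is_cycle_def by auto
  then show ?thesis using setvs by (intro exI[of _ vs] exI[of _ "map a vs"]) auto
qed

text \<open>The roots are the vertices that are not heads of arcs. If no arc entered a set without
  roots, each of its vertices would have a parent inside the set along an incoming arc, and
  \<open>cycle_of_parents\<close> would produce a cycle in \<open>F\<close>. A vertex covered by an
  edge is not covered by an arc as well, hence it is a root.\<close>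

lemma matching_forest_imp_branching:
  assumes F: "matching_forest G F" and FA: "F \<inter> arcs G \<subseteq> A"
  obtains R where "branching (F \<inter> arcs G) R" "\<And>e. e \<in> F \<inter> edges G \<Longrightarrow> ends G e \<subseteq> R"
    "\<And>e f. e \<in> F \<inter> edges G \<Longrightarrow> f \<in> F \<inter> edges G \<Longrightarrow> e \<noteq> f \<Longrightarrow> ends G e \<inter> ends G f = {}"
proof -
  have FEA: "F \<subseteq> edges G \<union> arcs G" and nc: "\<nexists>vs es. set es \<subseteq> F \<and> is_cycle G vs es"
    using F by (auto simp: matching_forest_def)
  have cov: "e = f" if "v \<in> heads G e" "v \<in> heads G f" "e \<in> F" "f \<in> F" for e f v
  proof -
    have "v \<in> verts G" using that heads_subset[of e] ends_subset[of e] FEA by blast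
    then show ?thesis using F that unfolding matching_forest_def covers_def by blast
  qed
  define B where "B = F \<inter> arcs G"
  have BA: "B \<subseteq> A" and finB: "finite B"
    using FA finite_arcs finite_subset by (auto simp: B_def)
  define R where "R = verts G - head G ` B"
  have "branching B R"
    unfolding branching_def
  proof (intro conjI ballI allI impI)
    fix v assume v: "v \<in> verts G"
    show "card {a \<in> B. head G a = v} = of_bool (v \<notin> R)"
    proof (cases "v \<in> R")
      case True
      then have none: "{a \<in> B. head G a = v} = {}" by (auto simp: R_def)
      show ?thesis unfolding none using True by simp
    next
      case False
      then obtain a where a: "a \<in> B" "head G a = v" using v by (auto simp: R_def)
      have one: "{a \<in> B. head G a = v} = {a}"
        using a cov[of v _ a] heads_arc by (auto simp: B_def)
      show ?thesis unfolding one using False by simp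
    qed
  next
    fix X assume X: "X \<subseteq> verts G" "X \<noteq> {}" "X \<inter> R = {}"
    show "entering B X \<noteq> {}"
    proof
      assume no: "entering B X = {}"
      have "\<exists>a p. a \<in> B \<and> p \<in> X \<and> ends G a = {v, p} \<and> head G a = v" if v: "v \<in> X" for v
      proof -
        obtain a where a: "a \<in> B" "head G a = v" using v X by (auto simp: R_def)
        then have "ends G a \<subseteq> X" using no v by (auto simp: entering_def)
        moreover have "card (ends G a) = 2" "v \<in> ends G a"
          using a card_ends[of a] heads_subset[of a] heads_arc[of a] by (auto simp: B_def)
        then obtain p where "ends G a = {v, p}"
          by (metis card_2_iff insert_commute insertE singletonD)
        ultimately show ?thesis using a by blast
      qed
      then obtain a p where ap: "\<And>v. v \<in> X \<Longrightarrow>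
          a v \<in> B \<and> p v \<in> X \<and> ends G (a v) = {v, p v} \<and> head G (a v) = v"
        by metis
      then obtain vs es where es: "set es \<subseteq> a ` X" "is_cycle G vs es"
        using cycle_of_parents[of X p a] X(2) finite_subset[OF X(1) finite_V] by metis
      have "set es \<subseteq> F" using es(1) ap by (auto simp: B_def)
      then have "\<exists>vs es. set es \<subseteq> F \<and> is_cycle G vs es" using es(2) by blast
      then show False using nc by blast
    qed
  qed (use BA in \<open>auto simp: R_def\<close>)
  moreover have "ends G e \<subseteq> R" if e: "e \<in> F \<inter> edges G" for e
  proof
    fix v assume v: "v \<in> ends G e"
    have "v \<noteq> head G a" if "a \<in> B" for a
    proof
      assume "v = head G a"
      then have "e = a"
        using cov[of v e a] that e v heads_edge[of e] heads_arc[of a] by (auto simp: B_def)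
      then show False using that e wf by (auto simp: B_def wf_mixed_graph_def)
    qed
    then show "v \<in> R" using v ends_subset[of e] e by (auto simp: R_def)
  qed
  moreover have "ends G e \<inter> ends G f = {}"
    if "e \<in> F \<inter> edges G" "f \<in> F \<inter> edges G" "e \<noteq> f" for e f
    using that cov[of _ e f] heads_edge by auto
  ultimately show ?thesis using that unfolding B_def by blast
qed

text \<open>Acyclicity follows by counting. A cycle has as many elements as vertices, and its head
  sets are nonempty, disjoint and made of cycle vertices; so each element has one head, which makes
  it an arc, and every cycle vertex is a head. Hence the vertex set avoids \<open>R\<close> and some
  arc enters it, but the only arc with that head belongs to the cycle.\<close>

lemma matching_forestI:
  assumes F: "F \<subseteq> edges G \<union> arcs G" and B: "branching (F \<inter> arcs G) R"
    and ER: "\<And>e. e \<in> F \<inter> edges G \<Longrightarrow> ends G e \<subseteq> R"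
    and EE: "\<And>e f. e \<in> F \<inter> edges G \<Longrightarrow> f \<in> F \<inter> edges G \<Longrightarrow> e \<noteq> f \<Longrightarrow> ends G e \<inter> ends G f = {}"
  shows "matching_forest G F"
proof -
  have disj: "edges G \<inter> arcs G = {}" using wf by (auto simp: wf_mixed_graph_def)
  have arc: "head G a \<notin> R" "\<And>b. b \<in> F \<inter> arcs G \<Longrightarrow> head G b = head G a \<Longrightarrow> b = a"
    if a: "a \<in> F \<inter> arcs G" for a
  proof -
    define W where "W = {x \<in> F \<inter> arcs G. head G x = head G a}"
    have c: "card W = of_bool (head G a \<notin> R)"
      using B a ends_subset[of a] heads_subset[of a] heads_arc[of a]
      unfolding branching_def W_def by blast
    have "W \<subseteq> A" using B by (auto simp: branching_def W_def)
    then have fin: "finite W" using finite_arcs finite_subset by blast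
    have mem: "a \<in> W" using a by (simp add: W_def)
    then have "card W \<noteq> 0" using fin by auto
    then show notin: "head G a \<notin> R" using c by (cases "head G a \<in> R") simp_all
    then obtain w where "W = {w}" using c card_1_singletonE[of W] by auto
    then show "b = a" if "b \<in> F \<inter> arcs G" "head G b = head G a" for b
      using mem that unfolding W_def by (metis (mono_tags, lifting) mem_Collect_eq singletonD)
  qed
  have cov: "e = f" if "e \<in> F" "f \<in> F" "v \<in> heads G e" "v \<in> heads G f" for e f v
  proof -
    have "e \<in> edges G \<union> arcs G" "f \<in> edges G \<union> arcs G" using F that by blast+
    then consider "e \<in> edges G" "f \<in> edges G" | "e \<in> edges G" "f \<in> arcs G"
      | "e \<in> arcs G" "f \<in> edges G" | "e \<in> arcs G" "f \<in> arcs G"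
      by blast
    then show ?thesis
    proof cases
      case 1
      then show ?thesis using EE[of e f] that heads_edge by auto
    next
      case 2
      then show ?thesis using ER[of e] arc(1)[of f] that heads_edge heads_arc by auto
    next
      case 3
      then show ?thesis using ER[of f] arc(1)[of e] that heads_edge heads_arc by auto
    next
      case 4
      then show ?thesis using arc(2)[of f e] that heads_arc by auto
    qed
  qed
  have "\<not> is_cycle G vs es" if es: "set es \<subseteq> F" for vs es
  proof
    assume cyc: "is_cycle G vs es"
    define X where "X = set vs"
    have len: "card X = card (set es)" "es \<noteq> []" "length vs = length es"
      using cyc by (auto simp: is_cycle_def X_def distinct_card)
    have endsX: "ends G e \<subseteq> X" if "e \<in> set es" for e
    proof -
      obtain i where "i < length es" "e = es ! i" using \<open>e \<in> set es\<close> by (metis in_set_conv_nth)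
      moreover have "Suc i mod length vs < length vs" using len by simp
      ultimately show ?thesis using cyc len unfolding is_cycle_def X_def by auto
    qed
    have inEA: "e \<in> edges G \<union> arcs G" if "e \<in> set es" for e using es F that by blast
    have headsX: "heads G e \<subseteq> X" if "e \<in> set es" for e
      using endsX heads_subset inEA that by blast
    have fin: "finite (heads G e)" if "e \<in> set es" for e
      using headsX[OF that] finite_subset by (auto simp: X_def)
    have one: "1 \<le> card (heads G e)" if "e \<in> set es" for e
      using inEA[OF that] heads_edge[of e] heads_arc[of e] card_ends[of e] by auto
    have "(\<Sum>e \<in> set es. card (heads G e)) = card (\<Union>e \<in> set es. heads G e)"
      using cov es fin by (intro card_UN_disjoint[symmetric]) (simp, simp, blast)
    also have "\<dots> \<le> card X" using headsX by (intro card_mono) (auto simp: X_def)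
    finally have le: "(\<Sum>e \<in> set es. card (heads G e)) \<le> card (set es)" using len by simp
    have all_one: "card (heads G e) = 1" if "e \<in> set es" for e
    proof (rule ccontr)
      assume "card (heads G e) \<noteq> 1"
      then have "(\<Sum>e \<in> set es. 1) < (\<Sum>e \<in> set es. card (heads G e))"
        using one that by (intro sum_strict_mono_ex1) (auto intro!: bexI[of _ e] simp: le_neq_implies_less)
      then show False using le by simp
    qed
    have es_arcs: "set es \<subseteq> F \<inter> arcs G"
    proof
      fix e assume "e \<in> set es"
      then show "e \<in> F \<inter> arcs G"
        using all_one[of e] inEA[of e] heads_edge[of e] card_ends[of e] es by auto
    qed
    have "card (head G ` set es) = card (set es)"
      using arc(2) es_arcs by (intro card_image inj_onI) blast
    moreover have "head G ` set es \<subseteq> X" using headsX heads_arc es_arcs by fastforce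
    ultimately have hX: "head G ` set es = X" using len(1) by (intro card_subset_eq) (auto simp: X_def)
    have "X \<inter> R = {}" using arc(1) es_arcs hX by blast
    moreover have "X \<noteq> {}" using hX len(2) by auto
    moreover have "X \<subseteq> verts G"
      using hX es_arcs heads_arc heads_subset ends_subset by fastforce
    ultimately have "entering (F \<inter> arcs G) X \<noteq> {}" using B by (auto simp: branching_def)
    then obtain a where a: "a \<in> F \<inter> arcs G" "head G a \<in> X" "\<not> ends G a \<subseteq> X"
      by (auto simp: entering_def)
    then obtain e where e: "e \<in> set es" "head G e = head G a" using hX by (metis imageE)
    then have "e = a" using arc(2)[OF a(1)] es_arcs by blast
    then show False using endsX e(1) a(3) by blast
  qed
  then show ?thesis using F cov unfolding matching_forest_def covers_def by blast
qed

section \<open>Rebalancing two matching forests\<close>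

lemma rebalance_two_matching_forests:
  assumes F: "matching_forest G F" and H: "matching_forest G H" and FH: "F \<inter> H = {}"
    and A: "(F \<union> H) \<inter> arcs G = A"
  obtains F' H' where "matching_forest G F'" "matching_forest G H'" "F' \<inter> H' = {}" "F' \<union> H' = F \<union> H"
    "\<bar>int (card F') - int (card H')\<bar> \<le> 2"
    "\<bar>int (card (F' \<inter> edges G)) - int (card (H' \<inter> edges G))\<bar> \<le> 1"
    "\<bar>int (card (F' \<inter> arcs G)) - int (card (H' \<inter> arcs G))\<bar> \<le> 2"
proof -
  define E where "E = F \<inter> edges G"
  define D where "D = H \<inter> edges G"
  define B where "B = F \<inter> arcs G"
  define C where "C = H \<inter> arcs G"
  have FHE: "F = E \<union> B" "H = D \<union> C"
    using F H by (auto simp: matching_forest_def E_def D_def B_def C_def)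
  have EA: "edges G \<inter> arcs G = {}" using wf by (auto simp: wf_mixed_graph_def)
  have fin: "finite E" "finite D"
    using finite_matching_forest[OF wf] F H by (auto simp: E_def D_def)
  have BCA: "B \<union> C = A" "B \<inter> C = {}" and ED: "E \<inter> D = {}"
    using A FH by (auto simp: B_def C_def E_def D_def)
  obtain R where R: "branching B R" "\<And>e. e \<in> E \<Longrightarrow> ends G e \<subseteq> R"
    "\<And>e f. e \<in> E \<Longrightarrow> f \<in> E \<Longrightarrow> e \<noteq> f \<Longrightarrow> ends G e \<inter> ends G f = {}"
    using matching_forest_imp_branching[OF F] BCA(1) unfolding B_def E_def by (metis Un_upper1)
  obtain S where S: "branching C S" "\<And>e. e \<in> D \<Longrightarrow> ends G e \<subseteq> S"
    "\<And>e f. e \<in> D \<Longrightarrow> f \<in> D \<Longrightarrow> e \<noteq> f \<Longrightarrow> ends G e \<inter> ends G f = {}"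
    using matching_forest_imp_branching[OF H] BCA(1) unfolding C_def D_def by (metis Un_upper2)
  have RS: "R \<subseteq> verts G" "S \<subseteq> verts G" using R S by (auto simp: branching_def)
  then have finRS: "finite R" "finite S" using finite_V finite_subset by auto
  obtain N where N: "\<And>p. p \<in> N \<Longrightarrow> \<exists>r \<in> R - S. \<exists>s \<in> S - R. p = {r, s}" "disjoint N"
    and exch: "\<And>Z. (\<And>p. p \<in> N \<Longrightarrow> p \<subseteq> Z \<or> p \<inter> Z = {}) \<Longrightarrow>
      \<exists>B' C'. branching B' (R - Z \<union> S \<inter> Z) \<and> branching C' (S - Z \<union> R \<inter> Z) \<and>
        B' \<union> C' = A \<and> B' \<inter> C' = {}"
    using branching_exchange[OF R(1) S(1) BCA] by metis
  have N_sub: "p \<subseteq> verts G" "card p = 2" if "p \<in> N" for p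
    using N(1)[OF that] RS by (auto simp: card_2_iff)
  have "finite N" using N_sub finite_V by (intro finite_subset[of N "Pow (verts G)"]) auto

  \<comment> \<open>The disjoint sum collects matching edges and pairs as the edges of one auxiliary
    graph; a pair is its own endpoint set.\<close>
  let ?en = "case_sum (ends G) id"
  let ?X = "(E \<union> D) <+> N"
  have edge_ends: "ends G e \<subseteq> verts G" "card (ends G e) = 2" if "e \<in> E \<union> D" for e
    using that ends_subset[of e] card_ends[of e] by (auto simp: E_def D_def)
  have finX: "finite ?X" using fin \<open>finite N\<close> by simp
  have enX: "?en x \<subseteq> verts G \<and> card (?en x) = 2" if "x \<in> ?X" for x
  proof (cases x)
    case (Inl e)
    then show ?thesis using that edge_ends[of e] by auto
  next
    case (Inr p)
    then show ?thesis using that N_sub[of p] by auto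
  qed
  obtain \<P> where P: "partition_on (verts G) \<P>" "\<forall>x \<in> ?X. \<exists>P \<in> \<P>. ?en x \<subseteq> P"
    and card_P: "\<And>P. P \<in> \<P> \<Longrightarrow> card P \<le> Suc (card {x \<in> ?X. ?en x \<subseteq> P})"
    using component_partition[of "verts G" ?X ?en, OF finite_V finX enX] by blast
  have finP: "finite \<P>" using P(1) finite_V finite_elements by blast
  have P_disj: "P = Q" if "P \<in> \<P>" "Q \<in> \<P>" "v \<in> P" "v \<in> Q" for P Q v
    using that P(1) by (auto simp: partition_on_def disjoint_def)
  have P_sub: "P \<subseteq> verts G" if "P \<in> \<P>" for P using that P(1) by (auto simp: partition_on_def)
  have fin_in_P: "finite P" if "P \<in> \<P>" for P using P_sub[OF that] finite_V finite_subset by blast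
  have E_part: "\<exists>P \<in> \<P>. ends G e \<subseteq> P" if "e \<in> E \<union> D" for e
    using P(2) that by (metis InlI old.sum.simps(5))
  have N_part: "\<exists>P \<in> \<P>. p \<subseteq> P" if "p \<in> N" for p
    using P(2) that by (metis InrI id_apply old.sum.simps(6))

  define inside where "inside M P = {e \<in> M. ends G e \<subseteq> P}" for M P
  define m where "m P = int (card (inside E P)) - int (card (inside D P))" for P
  \<comment> \<open>The vertices of \<open>P\<close> outside \<open>R\<close> are the heads in
    \<open>P\<close> of arcs of \<open>B\<close>, and likewise for \<open>S\<close> and
    \<open>C\<close>. The negated root difference is therefore the arc difference at
    \<open>P\<close>, and \<open>f P\<close> compares total sizes.\<close>
  define f where "f P = m P - (int (card (R \<inter> P)) - int (card (S \<inter> P)))" for P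
  have bounds: "\<bar>m P\<bar> \<le> 1 \<and> \<bar>f P\<bar> \<le> 1" if P_in: "P \<in> \<P>" for P
  proof -
    define n where "n = card {p \<in> N. p \<subseteq> P}"
    note fP = fin_in_P[OF P_in]
    have "{x \<in> ?X. ?en x \<subseteq> P} = (inside E P \<union> inside D P) <+> {p \<in> N. p \<subseteq> P}"
      by (auto simp: inside_def)
    moreover have "inside E P \<inter> inside D P = {}" using ED by (auto simp: inside_def)
    moreover have "finite (inside E P)" "finite (inside D P)" using fin by (auto simp: inside_def)
    ultimately have cP: "card P \<le> Suc (card (inside E P) + card (inside D P) + n)"
      using card_P[OF P_in] \<open>finite N\<close> by (simp add: card_Plus card_Un_disjoint n_def)
    have twice: "2 * card (inside M P) \<le> card (T \<inter> P)"
      if "finite M" "M \<subseteq> E \<union> D" "\<And>e. e \<in> M \<Longrightarrow> ends G e \<subseteq> T"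
        "\<And>e f. e \<in> M \<Longrightarrow> f \<in> M \<Longrightarrow> e \<noteq> f \<Longrightarrow> ends G e \<inter> ends G f = {}" for M T
    proof -
      have "2 * card (inside M P) = (\<Sum>e \<in> inside M P. card (ends G e))"
        using that(2) edge_ends(2) by (simp add: inside_def subset_iff)
      also have "\<dots> = card (\<Union>e \<in> inside M P. ends G e)"
        using that finite_subset[OF _ fP] by (intro card_UN_disjoint[symmetric]) (auto simp: inside_def)
      also have "\<dots> \<le> card (T \<inter> P)"
        using that(3) fP by (intro card_mono) (auto simp: inside_def)
      finally show ?thesis .
    qed
    \<comment> \<open>The pairs are disjoint, so picking a vertex of \<open>T\<close> from each is
      injective.\<close>
    have n_le: "n \<le> card (T \<inter> P)" if T: "\<And>p. p \<in> N \<Longrightarrow> p \<inter> T \<noteq> {}" for T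
    proof -
      have "\<forall>p \<in> N. \<exists>v. v \<in> p \<inter> T" using T by blast
      then obtain t where t: "\<And>p. p \<in> N \<Longrightarrow> t p \<in> p \<inter> T" by metis
      have "inj_on t {p \<in> N. p \<subseteq> P}"
      proof (rule inj_onI)
        fix p q assume "p \<in> {p \<in> N. p \<subseteq> P}" "q \<in> {p \<in> N. p \<subseteq> P}" "t p = t q"
        then have "p \<in> N" "q \<in> N" "t p \<in> p \<inter> q" using t[of p] t[of q] by auto
        then show "p = q" using N(2) unfolding disjoint_def by blast
      qed
      moreover have "t ` {p \<in> N. p \<subseteq> P} \<subseteq> T \<inter> P" using t by auto
      ultimately show ?thesis unfolding n_def using fP by (intro card_inj_on_le[of t]) auto
    qed
    have nR: "n \<le> card ((R - S) \<inter> P)" and nS: "n \<le> card ((S - R) \<inter> P)"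
      using N(1) by (intro n_le; fastforce)+
    have cR: "card (R \<inter> P) = card ((R - S) \<inter> P) + card (R \<inter> S \<inter> P)"
      using fP by (subst card_Un_disjoint[symmetric]) (auto intro!: arg_cong[of _ _ card])
    have cS: "card (S \<inter> P) = card ((S - R) \<inter> P) + card (R \<inter> S \<inter> P)"
      using fP by (subst card_Un_disjoint[symmetric]) (auto intro!: arg_cong[of _ _ card])
    have "card (R \<inter> P) + card ((S - R) \<inter> P) = card (R \<inter> P \<union> (S - R) \<inter> P)"
      using fP by (intro card_Un_disjoint[symmetric]) auto
    also have "\<dots> \<le> card P" using fP by (intro card_mono) auto
    finally have cU: "card (R \<inter> P) + card ((S - R) \<inter> P) \<le> card P" .
    have "2 * card (inside E P) \<le> card (R \<inter> P)" "2 * card (inside D P) \<le> card (S \<inter> P)"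
      using twice[of E R] twice[of D S] fin R S by auto
    \<comment> \<open>Let \<open>e\<close>, \<open>d\<close> be the edge counts and
      \<open>r\<close>, \<open>q\<close> the root counts of the two forests in \<open>P\<close>. As
      \<open>R - S\<close> and \<open>S - R\<close> have at least \<open>n\<close> vertices each in
      \<open>P\<close>, counting \<open>R \<union> S\<close> there shows that \<open>r\<close> and
      \<open>q\<close> are at most \<open>e + d + 1\<close>. Together with
      \<open>2 * e \<le> r\<close> and \<open>2 * d \<le> q\<close> this bounds \<open>e - d\<close>
      and \<open>e - d - r + q\<close> by 1 in absolute value.\<close>
    then show ?thesis
      using cP nR nS cR cS cU unfolding m_def f_def by linarith
  qed
  obtain s where s: "\<And>P. s P \<in> {1, -1 :: int}" and sm: "\<bar>\<Sum>P \<in> \<P>. s P * m P\<bar> \<le> 1"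
    and sf: "\<bar>\<Sum>P \<in> \<P>. s P * f P\<bar> \<le> 2"
    and sb: "\<bar>(\<Sum>P \<in> \<P>. s P * f P) - (\<Sum>P \<in> \<P>. s P * m P)\<bar> \<le> 2"
    using balancing_signs[of \<P> m f, OF finP bounds] by blast

  \<comment> \<open>The exchange takes place on the blocks of sign -1. Every edge and every pair
    lies in one block, hence inside \<open>Z\<close> or off it.\<close>
  define Z where "Z = \<Union> {P \<in> \<P>. s P = -1}"
  have Z_P: "P \<subseteq> Z" if "P \<in> \<P>" "s P = -1" for P using that by (auto simp: Z_def)
  have Z_P': "P \<inter> Z = {}" if "P \<in> \<P>" "s P \<noteq> -1" for P
    using that P_disj by (auto simp: Z_def)
  have closed_Z: "X \<subseteq> Z \<or> X \<inter> Z = {}" if "P \<in> \<P>" "X \<subseteq> P" for X P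
    using Z_P Z_P' that by blast
  have "p \<subseteq> Z \<or> p \<inter> Z = {}" if "p \<in> N" for p
    using N_part[OF that] closed_Z by blast
  then obtain B' C' where BC': "branching B' (R - Z \<union> S \<inter> Z)" "branching C' (S - Z \<union> R \<inter> Z)"
    "B' \<union> C' = A" "B' \<inter> C' = {}"
    using exch by meson
  have edge_Z: "ends G e \<subseteq> Z \<or> ends G e \<inter> Z = {}" if "e \<in> E \<union> D" for e
    using E_part[OF that] closed_Z by blast
  \<comment> \<open>An edge inside \<open>Z\<close> changes sides together with the roots at its
    endpoints, so edges still end at roots. Edges of different origin in the same new matching are
    separated by \<open>Z\<close>.\<close>
  define E' where "E' = {e \<in> E. \<not> ends G e \<subseteq> Z} \<union> {e \<in> D. ends G e \<subseteq> Z}"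
  define D' where "D' = {e \<in> D. \<not> ends G e \<subseteq> Z} \<union> {e \<in> E. ends G e \<subseteq> Z}"
  have ED': "E' \<subseteq> edges G" "D' \<subseteq> edges G" "E' \<union> D' = E \<union> D" "E' \<inter> D' = {}" "finite E'" "finite D'"
  proof -
    show "E' \<subseteq> edges G" "D' \<subseteq> edges G" by (auto simp: E'_def D'_def E_def D_def)
    show "E' \<union> D' = E \<union> D" "E' \<inter> D' = {}" using ED by (auto simp: E'_def D'_def)
    show "finite E'" "finite D'" using fin by (auto simp: E'_def D'_def)
  qed
  have BC'_arcs: "B' \<subseteq> arcs G" "C' \<subseteq> arcs G" using BC'(3) arcs_subset by auto
  have finBC': "finite B'" "finite C'" using BC'(3) finite_arcs by auto
  have parts: "(E' \<union> B') \<inter> edges G = E'" "(D' \<union> C') \<inter> edges G = D'"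
    "(E' \<union> B') \<inter> arcs G = B'" "(D' \<union> C') \<inter> arcs G = C'"
    using ED' BC'_arcs EA by blast+
  have mfF: "matching_forest G (E' \<union> B')"
  proof (rule matching_forestI, unfold parts)
    show "E' \<union> B' \<subseteq> edges G \<union> arcs G" using ED' BC'_arcs by blast
    show "branching B' (R - Z \<union> S \<inter> Z)" by (rule BC')
    show "ends G e \<subseteq> R - Z \<union> S \<inter> Z" if "e \<in> E'" for e
      using that edge_Z[of e] R(2)[of e] S(2)[of e] unfolding E'_def by blast
    show "ends G e \<inter> ends G g = {}" if "e \<in> E'" "g \<in> E'" "e \<noteq> g" for e g
      using that edge_Z[of e] edge_Z[of g] R(3)[of e g] S(3)[of e g] unfolding E'_def by blast
  qed
  have mfH: "matching_forest G (D' \<union> C')"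
  proof (rule matching_forestI, unfold parts)
    show "D' \<union> C' \<subseteq> edges G \<union> arcs G" using ED' BC'_arcs by blast
    show "branching C' (S - Z \<union> R \<inter> Z)" by (rule BC')
    show "ends G e \<subseteq> S - Z \<union> R \<inter> Z" if "e \<in> D'" for e
      using that edge_Z[of e] R(2)[of e] S(2)[of e] unfolding D'_def by blast
    show "ends G e \<inter> ends G g = {}" if "e \<in> D'" "g \<in> D'" "e \<noteq> g" for e g
      using that edge_Z[of e] edge_Z[of g] R(3)[of e g] S(3)[of e g] unfolding D'_def by blast
  qed

  have card_edges: "int (card M) = (\<Sum>P \<in> \<P>. int (card (inside M P)))" if "M \<subseteq> E \<union> D" for M
  proof -
    have finM: "finite M" using that fin finite_subset by blast
    have "M = (\<Union>P \<in> \<P>. inside M P)" using E_part that by (auto simp: inside_def)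
    moreover have "inside M P \<inter> inside M Q = {}" if "P \<in> \<P>" "Q \<in> \<P>" "P \<noteq> Q" for P Q
    proof (rule ccontr)
      assume "inside M P \<inter> inside M Q \<noteq> {}"
      then obtain e where e: "e \<in> M" "ends G e \<subseteq> P" "ends G e \<subseteq> Q" by (auto simp: inside_def)
      then have "ends G e \<noteq> {}" using edge_ends(2)[of e] \<open>M \<subseteq> E \<union> D\<close> by auto
      then show False using e P_disj that by blast
    qed
    ultimately have "card M = (\<Sum>P \<in> \<P>. card (inside M P))"
      using card_UN_disjoint[of \<P> "inside M"] finP finM by (simp add: inside_def)
    then show ?thesis by simp
  qed
  have card_roots: "int (card T) = (\<Sum>P \<in> \<P>. int (card (T \<inter> P)))" if "T \<subseteq> verts G" for T
  proof -
    have "finite T" using that finite_V finite_subset by blast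
    moreover have "T = (\<Union>P \<in> \<P>. T \<inter> P)" using that P(1) by (auto simp: partition_on_def)
    moreover have "(T \<inter> P) \<inter> (T \<inter> Q) = {}" if "P \<in> \<P>" "Q \<in> \<P>" "P \<noteq> Q" for P Q
      using that P_disj by blast
    ultimately have "card T = (\<Sum>P \<in> \<P>. card (T \<inter> P))"
      using card_UN_disjoint[of \<P> "\<lambda>P. T \<inter> P"] finP by simp
    then show ?thesis by simp
  qed
  have diff_m: "int (card E') - int (card D') = (\<Sum>P \<in> \<P>. s P * m P)"
  proof -
    have part: "int (card (inside E' P)) - int (card (inside D' P)) = s P * m P" if "P \<in> \<P>" for P
    proof (cases "s P = -1")
      case True
      then have "inside E' P = inside D P" "inside D' P = inside E P"
        using Z_P[OF that] by (auto simp: inside_def E'_def D'_def)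
      then show ?thesis using True by (simp add: m_def)
    next
      case False
      have "\<not> ends G e \<subseteq> Z" if "e \<in> E \<union> D" "ends G e \<subseteq> P" for e
      proof -
        have "ends G e \<noteq> {}" using edge_ends(2)[OF that(1)] by auto
        then show ?thesis using that(2) Z_P'[OF \<open>P \<in> \<P>\<close> False] by blast
      qed
      then have "inside E' P = inside E P" "inside D' P = inside D P"
        by (auto simp: inside_def E'_def D'_def)
      then show ?thesis using False s[of P] by (simp add: m_def)
    qed
    have "E' \<subseteq> E \<union> D" "D' \<subseteq> E \<union> D" using ED'(3) by auto
    then show ?thesis
      unfolding card_edges[OF \<open>E' \<subseteq> E \<union> D\<close>] card_edges[OF \<open>D' \<subseteq> E \<union> D\<close>] sum_subtractf[symmetric]
      by (intro sum.cong refl part)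
  qed
  have diff_r: "int (card (R - Z \<union> S \<inter> Z)) - int (card (S - Z \<union> R \<inter> Z))
      = (\<Sum>P \<in> \<P>. s P * (m P - f P))"
  proof -
    have part: "int (card ((R - Z \<union> S \<inter> Z) \<inter> P)) - int (card ((S - Z \<union> R \<inter> Z) \<inter> P))
        = s P * (m P - f P)" if "P \<in> \<P>" for P
    proof (cases "s P = -1")
      case True
      then have "(R - Z \<union> S \<inter> Z) \<inter> P = S \<inter> P" "(S - Z \<union> R \<inter> Z) \<inter> P = R \<inter> P"
        using Z_P[OF that] by auto
      then show ?thesis using True by (simp add: f_def)
    next
      case False
      then have "(R - Z \<union> S \<inter> Z) \<inter> P = R \<inter> P" "(S - Z \<union> R \<inter> Z) \<inter> P = S \<inter> P"
        using Z_P'[OF that] by auto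
      then show ?thesis using False s[of P] by (simp add: f_def)
    qed
    have sub: "R - Z \<union> S \<inter> Z \<subseteq> verts G" "S - Z \<union> R \<inter> Z \<subseteq> verts G" using RS by auto
    show ?thesis
      unfolding card_roots[OF sub(1)] card_roots[OF sub(2)] sum_subtractf[symmetric]
      by (intro sum.cong refl part)
  qed
  \<comment> \<open>By \<open>card_branching\<close> the arc difference is minus the root
    difference.\<close>
  have diff_b: "int (card B') - int (card C') = (\<Sum>P \<in> \<P>. s P * f P) - (\<Sum>P \<in> \<P>. s P * m P)"
    using diff_r card_branching[OF BC'(1)] card_branching[OF BC'(2)]
    by (simp add: right_diff_distrib sum_subtractf)
  have "card (E' \<union> B') = card E' + card B'" "card (D' \<union> C') = card D' + card C'"
    using ED' BC'_arcs EA finBC' by (intro card_Un_disjoint; blast)+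
  then have diff_f: "int (card (E' \<union> B')) - int (card (D' \<union> C')) = (\<Sum>P \<in> \<P>. s P * f P)"
    using diff_m diff_b by simp
  show ?thesis
  proof (rule that[OF mfF mfH])
    show "(E' \<union> B') \<inter> (D' \<union> C') = {}" using ED' BC' BC'_arcs EA by blast
    show "E' \<union> B' \<union> (D' \<union> C') = F \<union> H" using ED'(3) BC'(3) BCA(1) FHE by blast
  qed (use parts diff_m diff_b diff_f sm sf sb in simp_all)
qed

end

section \<open>Balancing all pairs of classes at once\<close>

theorem theorem2:
  fixes G :: "('v, 'e) mixed_graph" and k :: nat
  assumes "wf_mixed_graph G"
    and "k \<ge> 1"
    and "\<exists>F. matching_forest_partition G k F"
  shows "\<exists>F. matching_forest_partition G k F \<and>
    (\<forall>i \<in> {1..k}. \<forall>j \<in> {1..k}.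
       \<bar>int (card (F i)) - int (card (F j))\<bar> \<le> 2 \<and>
       \<bar>int (card (F i \<inter> edges G)) - int (card (F j \<inter> edges G))\<bar> \<le> 1 \<and>
       \<bar>int (card (F i \<inter> arcs G)) - int (card (F j \<inter> arcs G))\<bar> \<le> 2)"
proof -
  \<comment> \<open>The weights match \<open>sum_squares_decrease\<close> once
    \<open>card_split\<close> writes the total size as edges plus arcs.\<close>
  define w :: "'e set \<Rightarrow> int" where
    "w X = 3 * (int (card (X \<inter> edges G)))\<^sup>2 + (int (card (X \<inter> arcs G)))\<^sup>2 + (int (card X))\<^sup>2" for X
  have w_nonneg: "0 \<le> w X" for X by (simp add: w_def)
  define \<Phi> where "\<Phi> F = nat (\<Sum>i = 1..k. w (F i))" for F
  obtain F where F: "matching_forest_partition G k F"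
    and min: "\<And>F'. matching_forest_partition G k F' \<Longrightarrow> \<Phi> F \<le> \<Phi> F'"
    using assms(3) ex_has_least_nat[of "matching_forest_partition G k" _ \<Phi>] by metis
  have mf: "matching_forest G (F i)" if "i \<in> {1..k}" for i
    using F that by (simp add: matching_forest_partition_def)
  have F_disj: "F l \<inter> F l' = {}" if "l \<in> {1..k}" "l' \<in> {1..k}" "l \<noteq> l'" for l l'
    using F that unfolding matching_forest_partition_def disjoint_family_on_def by blast
  have card_split: "int (card X) = int (card (X \<inter> edges G)) + int (card (X \<inter> arcs G))"
    if "matching_forest G X" for X
  proof -
    have "X = X \<inter> edges G \<union> X \<inter> arcs G" using that by (auto simp: matching_forest_def)
    moreover have "edges G \<inter> arcs G = {}" using assms(1) by (auto simp: wf_mixed_graph_def)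
    ultimately have "card X = card (X \<inter> edges G) + card (X \<inter> arcs G)"
      using finite_matching_forest[OF assms(1) that] card_Un_disjoint[of "X \<inter> edges G" "X \<inter> arcs G"]
      by auto
    then show ?thesis by simp
  qed
  let ?good = "\<lambda>X Y. \<bar>int (card X) - int (card Y)\<bar> \<le> 2 \<and>
    \<bar>int (card (X \<inter> edges G)) - int (card (Y \<inter> edges G))\<bar> \<le> 1 \<and>
    \<bar>int (card (X \<inter> arcs G)) - int (card (Y \<inter> arcs G))\<bar> \<le> 2"
  have "?good (F i) (F j)" if ij: "i \<in> {1..k}" "j \<in> {1..k}" for i j
  proof (rule ccontr)
    assume bad: "\<not> ?good (F i) (F j)"
    then have "i \<noteq> j" by auto
    then have disj: "F i \<inter> F j = {}" using F_disj ij by blast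
    note fin = finite_matching_forest[OF assms(1)]
    interpret mixed_graph_arcs G "(F i \<union> F j) \<inter> arcs G"
      using assms(1) fin mf ij by unfold_locales auto
    obtain X Y where XY: "matching_forest G X" "matching_forest G Y" "X \<inter> Y = {}" "X \<union> Y = F i \<union> F j"
      and good: "?good X Y"
      using rebalance_two_matching_forests[OF mf[OF ij(1)] mf[OF ij(2)] disj refl] by metis
    define F' where "F' = F(i := X, j := Y)"
    have F'_simps: "F' i = X" "F' j = Y" "\<And>l. l \<noteq> i \<Longrightarrow> l \<noteq> j \<Longrightarrow> F' l = F l"
      using \<open>i \<noteq> j\<close> by (auto simp: F'_def)
    have "matching_forest_partition G k F'"
      unfolding matching_forest_partition_def
    proof (intro conjI ballI)
      show "matching_forest G (F' l)" if "l \<in> {1..k}" for l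
        using that mf XY by (auto simp: F'_def)
      have other: "F l \<inter> (X \<union> Y) = {}" if "l \<in> {1..k}" "l \<noteq> i" "l \<noteq> j" for l
        unfolding XY(4) using F_disj[OF that(1) ij(1)] F_disj[OF that(1) ij(2)] that by blast
      show "disjoint_family_on F' {1..k}"
        unfolding disjoint_family_on_def
      proof (intro ballI impI)
        fix l l' assume l: "l \<in> {1..k}" "l' \<in> {1..k}" "l \<noteq> l'"
        show "F' l \<inter> F' l' = {}"
          using F_disj[OF l] other[OF l(1)] other[OF l(2)] XY(3) l(3) unfolding F'_def by auto
      qed
      have "(\<Union>l \<in> {1..k}. F' l) = (\<Union>l \<in> {1..k} - {i, j}. F' l) \<union> (F' i \<union> F' j)" using ij by auto
      also have "\<dots> = (\<Union>l \<in> {1..k} - {i, j}. F l) \<union> (F i \<union> F j)" using F'_simps XY(4) by auto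
      also have "\<dots> = (\<Union>l \<in> {1..k}. F l)" using ij by auto
      also have "\<dots> = edges G \<union> arcs G" using F by (simp add: matching_forest_partition_def)
      finally show "(\<Union>l \<in> {1..k}. F' l) = edges G \<union> arcs G" .
    qed
    then have "\<Phi> F \<le> \<Phi> F'" by (rule min)
    moreover have "w X + w Y < w (F i) + w (F j)"
    proof -
      \<comment> \<open>Used with \<open>T\<close> the set of edges and the set of arcs: rebalancing
        preserves both sums over the pair.\<close>
      have int_sum: "int (card (X \<inter> T)) + int (card (Y \<inter> T)) = int (card (F i \<inter> T)) + int (card (F j \<inter> T))" for T
      proof -
        have "card (X \<inter> T) + card (Y \<inter> T) = card ((X \<union> Y) \<inter> T)"
          using XY(1-3) fin by (subst card_Un_disjoint[symmetric]) (auto simp: Int_Un_distrib2)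
        also have "\<dots> = card (F i \<inter> T) + card (F j \<inter> T)"
          unfolding XY(4) using mf ij fin disj
          by (subst card_Un_disjoint[symmetric]) (auto simp: Int_Un_distrib2)
        finally show ?thesis by (simp flip: of_nat_add)
      qed
      note cs = card_split[OF XY(1)] card_split[OF XY(2)] card_split[OF mf[OF ij(1)]] card_split[OF mf[OF ij(2)]]
      show ?thesis
        unfolding w_def cs
        by (rule sum_squares_decrease) (use int_sum good bad in \<open>simp_all add: cs\<close>)
    qed
    moreover have "(\<Sum>l = 1..k. w (g l)) = w (g i) + w (g j) + (\<Sum>l \<in> {1..k} - {i, j}. w (g l))" for g
    proof -
      have "(\<Sum>l = 1..k. w (g l)) = (\<Sum>l \<in> {i, j}. w (g l)) + (\<Sum>l \<in> {1..k} - {i, j}. w (g l))"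
        using ij by (subst sum.subset_diff[of "{i, j}"]) auto
      then show ?thesis using \<open>i \<noteq> j\<close> by simp
    qed
    moreover have "(\<Sum>l \<in> {1..k} - {i, j}. w (F' l)) = (\<Sum>l \<in> {1..k} - {i, j}. w (F l))"
      by (intro sum.cong) (auto simp: F'_simps)
    \<comment> \<open>Nonnegativity turns the comparison of the \<open>nat\<close> values in
      \<open>\<Phi>\<close> back into one of integers.\<close>
    moreover have "0 \<le> (\<Sum>l = 1..k. w (F' l))" using w_nonneg by (intro sum_nonneg)
    ultimately show False unfolding \<Phi>_def by (simp add: F'_simps nat_le_eq_zle)
  qed
  then show ?thesis using F by blast
qed

end
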